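(* Let $m \geq 3$ be odd. Then, as $n \to \infty$, the number of independent sets of the discrete torus $\mathbb{Z}_m^n$ satisfies \[ |\mathcal{I}(\mathbb{Z}_m^n)| \geq 2^{\lfloor m/2 \rfloor m^{n-1}} \cdot \exp\big( (1-o(1)) (m/2)^{n-1} \big). \]
   Context: For $m,n\in\mathbb{N}$, the discrete torus $\mathbb{Z}_m^n$ is the graph with vertex set $\{0,1,\ldots,m-1\}^n$ in which $u,v$ are adjacent iff there is $j\in[n]$ with $u_j \equiv v_j \pm 1 \pmod m$ and $u_i=v_i$ for all $i\neq j$. $\mathcal{I}(G)$ is the set of independent sets of a graph $G$. $o(1)$ denotes a quantity tending to $0$ as $n\to\infty$ (with $m$ fixed). *)

theory Defs
  imports
    "HOL-Analysis.Analysis"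
    "HOL-Number_Theory.Cong"
    "Graph_Theory.Graph_Theory"
begin

text \<open>
  Simple graphs are symmetric loop-free digraphs, as in the library's locales \<^locale>\<open>graph\<close>
  and \<^locale>\<open>pair_graph\<close>. The coordinates of a vertex are indexed by $0, \ldots, n-1$, and a
  vertex is an extensional function, so that vertices are counted exactly once.
\<close>

definition discrete_torus :: "nat \<Rightarrow> nat \<Rightarrow> (nat \<Rightarrow> nat) pair_pre_digraph" where
  "discrete_torus m n =
     (let V = {..<n} \<rightarrow>\<^sub>E {..<m} in
      \<lparr> pverts = V,
        parcs = {(u, v). u \<in> V \<and> v \<in> V \<and>
          (\<exists>j<n. ([int (u j) = int (v j) + 1] (mod int m) \<or>
                  [int (u j) = int (v j) - 1] (mod int m)) \<and>
                 (\<forall>i<n. i \<noteq> j \<longrightarrow> u i = v i))} \<rparr>)"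

definition independent_sets :: "('a, 'b) pre_digraph \<Rightarrow> 'a set set" where
  "independent_sets G = {S. S \<subseteq> verts G \<and> (\<forall>u\<in>S. \<forall>v\<in>S. \<not> u \<rightarrow>\<^bsub>G\<^esub> v)}"

text \<open>For $m = 1$ the adjacency condition would produce loops.\<close>

lemma pair_graph_discrete_torus:
  assumes "m \<ge> 2"
  shows "pair_graph (discrete_torus m n)"
proof -
  define V :: "(nat \<Rightarrow> nat) set" where "V = {..<n} \<rightarrow>\<^sub>E {..<m}"
  define N where "N a b \<longleftrightarrow> [int a = int b + 1] (mod int m) \<or> [int a = int b - 1] (mod int m)"
    for a b
  define R where "R = {(u, v). u \<in> V \<and> v \<in> V \<and> (\<exists>j<n. N (u j) (v j) \<and> (\<forall>i<n. i \<noteq> j \<longrightarrow> u i = v i))}"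
  have G: "discrete_torus m n = \<lparr> pverts = V, parcs = R \<rparr>"
    unfolding discrete_torus_def Let_def V_def N_def R_def ..
  have fin: "finite V"
    unfolding V_def by (simp add: finite_PiE)
  have sub: "R \<subseteq> V \<times> V"
    unfolding R_def by blast
  have N_sym: "N b a" if "N a b" for a b
    using that unfolding N_def
    by (simp add: cong_iff_dvd_diff) (smt (verit) dvd_diff_commute)
  have N_irrefl: "\<not> N a a" for a
    using assms unfolding N_def by (simp add: cong_iff_dvd_diff)
  have R_sym: "(v, u) \<in> R" if "(u, v) \<in> R" for u v
  proof -
    from that obtain j where "u \<in> V" "v \<in> V" "j < n" "N (u j) (v j)" "\<forall>i<n. i \<noteq> j \<longrightarrow> u i = v i"
      unfolding R_def by blast
    then have "v \<in> V \<and> u \<in> V \<and> j < n \<and> N (v j) (u j) \<and> (\<forall>i<n. i \<noteq> j \<longrightarrow> v i = u i)"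
      using N_sym by simp
    then show ?thesis
      unfolding R_def by blast
  qed
  have R_irrefl: "(u, u) \<notin> R" for u
    unfolding R_def using N_irrefl by blast
  show ?thesis
    unfolding G
  proof unfold_locales
    fix e assume "e \<in> parcs \<lparr> pverts = V, parcs = R \<rparr>"
    then show "fst e \<in> pverts \<lparr> pverts = V, parcs = R \<rparr>" "snd e \<in> pverts \<lparr> pverts = V, parcs = R \<rparr>"
      "fst e \<noteq> snd e"
      using sub R_irrefl by (cases e; auto)+
  next
    show "finite (pverts \<lparr> pverts = V, parcs = R \<rparr>)" "finite (parcs \<lparr> pverts = V, parcs = R \<rparr>)"
      using fin finite_subset[OF sub] by simp_all
  next
    show "symmetric (with_proj \<lparr> pverts = V, parcs = R \<rparr>)"
      using R_sym by (simp add: symmetric_def arcs_ends_def arc_to_ends_def sym_def)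
  qed
qed

end

theory Submission
  imports Defs "HOL-Real_Asymp.Real_Asymp"
begin

text \<open>
  Call the coordinate sum of a vertex modulo $m$ its level. The vertices of level
  $0, 2, \ldots, m - 3$ form an independent set $I$ of size $\lfloor m/2 \rfloor m^{n-1}$, and each of
  the $2 m^{n-1}$ vertices in the levels $m - 2$ and $m - 1$ has at most $n$ neighbours in $I$.
  Choosing first an independent set $T$ of such defects and then any subset of $I$ avoiding the
  neighbours of $T$ gives at least $2^{|I|} Z$ independent sets, where $Z$ is the hard-core partition
  function of the defect graph at fugacity $\lambda = 2^{-n}$. Removing a vertex changes a partition
  function by a factor of at most $1 + \lambda$, so adding a vertex of degree at most $d$ multiplies it
  by at least $1 + \lambda (1 + \lambda)^{-d}$. With $d = 2 n$ this is $1 + (1 - o(1)) 2^{-n}$,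
  whence $Z \ge \exp ((1 - o(1)) 2 m^{n-1} 2^{-n})$.
\<close>

section \<open>The hard-core partition function\<close>

text \<open>Stated for a bare relation and a vertex set, so that induced subgraphs are obtained by
  changing \<open>A\<close> alone.\<close>

definition independent_subsets :: "('a \<Rightarrow> 'a \<Rightarrow> bool) \<Rightarrow> 'a set \<Rightarrow> 'a set set" where
  "independent_subsets E A = {T. T \<subseteq> A \<and> (\<forall>u\<in>T. \<forall>v\<in>T. \<not> E u v)}"

definition hard_core :: "('a \<Rightarrow> 'a \<Rightarrow> bool) \<Rightarrow> real \<Rightarrow> 'a set \<Rightarrow> real" where
  "hard_core E l A = (\<Sum>T\<in>independent_subsets E A. l ^ card T)"

lemma finite_independent_subsets: "finite A \<Longrightarrow> finite (independent_subsets E A)"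
  by (rule finite_subset[of _ "Pow A"]) (auto simp: independent_subsets_def)

lemma hard_core_empty [simp]: "hard_core E l {} = 1"
proof -
  have "independent_subsets E {} = {{}}"
    by (auto simp: independent_subsets_def)
  then show ?thesis by (simp add: hard_core_def)
qed

lemma hard_core_mono:
  assumes "finite B" "A \<subseteq> B" "l \<ge> 0"
  shows "hard_core E l A \<le> hard_core E l B"
  unfolding hard_core_def
  using assms by (intro sum_mono2 finite_independent_subsets) (auto simp: independent_subsets_def)

text \<open>The deletion recurrence: independent sets avoiding \<open>v\<close> give the first term,
  and those containing \<open>v\<close> arise by adding \<open>v\<close> to an independent set of
  non-neighbours. Symmetry lets the one-sided condition \<open>\<not> E u v\<close> exclude arcs in
  both directions.\<close>

lemma hard_core_insert:
  assumes fin: "finite A" and "v \<notin> A" and "symp E" and "irreflp E"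
  shows "hard_core E l (insert v A) = hard_core E l A + l * hard_core E l {u \<in> A. \<not> E u v}"
proof -
  let ?B = "{u \<in> A. \<not> E u v}"
  have split: "independent_subsets E (insert v A)
      = independent_subsets E A \<union> insert v ` independent_subsets E ?B" (is "?L = ?R")
  proof
    show "?L \<subseteq> ?R"
    proof
      fix T assume T: "T \<in> ?L"
      show "T \<in> ?R"
      proof (cases "v \<in> T")
        case True
        then have "T = insert v (T - {v})" by blast
        moreover have "T - {v} \<in> independent_subsets E ?B"
          using T True by (auto simp: independent_subsets_def)
        ultimately show ?thesis by blast
      qed (use T in \<open>auto simp: independent_subsets_def\<close>)
    qed
    show "?R \<subseteq> ?L"
      using \<open>symp E\<close> \<open>irreflp E\<close>
      by (fastforce simp: independent_subsets_def irreflp_def dest: sympD)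
  qed
  have notin: "v \<notin> T" "finite T" if "T \<in> independent_subsets E ?B" for T
    using that \<open>v \<notin> A\<close> finite_subset[of T A] fin by (auto simp: independent_subsets_def)
  have inj: "inj_on (insert v) (independent_subsets E ?B)"
    using notin by (intro inj_onI) (metis Diff_insert_absorb)
  have "hard_core E l (insert v A)
      = hard_core E l A + (\<Sum>T\<in>insert v ` independent_subsets E ?B. l ^ card T)"
    unfolding hard_core_def split using fin \<open>v \<notin> A\<close>
    by (intro sum.union_disjoint finite_imageI finite_independent_subsets)
      (auto simp: independent_subsets_def)
  also have "(\<Sum>T\<in>insert v ` independent_subsets E ?B. l ^ card T)
      = (\<Sum>T\<in>independent_subsets E ?B. l * l ^ card T)"
    using notin by (simp add: sum.reindex[OF inj])
  finally show ?thesis by (simp add: hard_core_def sum_distrib_left)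
qed

text \<open>In the deletion recurrence the second partition function is at most the first by
  monotonicity, so each new vertex costs a factor of at most \<open>1 + l\<close>.\<close>

lemma hard_core_union_le:
  assumes "finite A" "finite B" "symp E" "irreflp E" "l \<ge> 0"
  shows "hard_core E l (A \<union> B) \<le> (1 + l) ^ card B * hard_core E l A"
  using \<open>finite B\<close>
proof (induction B rule: finite_induct)
  case (insert v B)
  have ge: "1 * hard_core E l (A \<union> B) \<le> (1 + l) * hard_core E l (A \<union> B)"
    using \<open>l \<ge> 0\<close> by (intro mult_right_mono) (auto simp: hard_core_def intro!: sum_nonneg)
  have "hard_core E l (A \<union> insert v B) \<le> (1 + l) * hard_core E l (A \<union> B)"
  proof (cases "v \<in> A")
    case True
    then show ?thesis using ge by (simp add: insert_absorb)
  next
    case False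
    have "hard_core E l {u \<in> A \<union> B. \<not> E u v} \<le> hard_core E l (A \<union> B)"
      using insert assms by (intro hard_core_mono) auto
    then have "l * hard_core E l {u \<in> A \<union> B. \<not> E u v} \<le> l * hard_core E l (A \<union> B)"
      using \<open>l \<ge> 0\<close> by (rule mult_left_mono)
    then show ?thesis
      using hard_core_insert[of "A \<union> B" v E l] False insert assms by (simp add: algebra_simps)
  qed
  also have "\<dots> \<le> (1 + l) * ((1 + l) ^ card B * hard_core E l A)"
    using insert \<open>l \<ge> 0\<close> by (intro mult_left_mono) auto
  finally show ?case using insert by simp
qed simp

text \<open>Each inserted vertex gains a factor: in the deletion recurrence, dropping its at most
  \<open>d\<close> neighbours shrinks the partition function by at most
  \<open>(1 + l) ^ d\<close>.\<close>

lemma hard_core_ge: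
  assumes "finite A" "symp E" "irreflp E" "l \<ge> 0"
    and deg: "\<And>v. v \<in> A \<Longrightarrow> card {u \<in> A. E u v} \<le> d"
  shows "(1 + l / (1 + l) ^ d) ^ card A \<le> hard_core E l A"
  using \<open>finite A\<close> deg
proof (induction A rule: finite_induct)
  case (insert v A)
  let ?N = "{u \<in> A. E u v}" and ?B = "{u \<in> A. \<not> E u v}"
  have mono: "card {u \<in> A. E u w} \<le> card {u \<in> insert v A. E u w}" for w
    using insert by (intro card_mono) auto
  have le: "card {u \<in> A. E u w} \<le> d" if "w \<in> insert v A" for w
    using insert.prems[OF that] mono[of w] by simp
  have nonneg: "0 \<le> hard_core E l ?B"
    using \<open>l \<ge> 0\<close> by (auto simp: hard_core_def intro!: sum_nonneg)
  have "?B \<union> ?N = A" by blast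
  then have "hard_core E l A \<le> (1 + l) ^ card ?N * hard_core E l ?B"
    using hard_core_union_le[of ?B ?N E l] insert assms by simp
  also have "\<dots> \<le> (1 + l) ^ d * hard_core E l ?B"
    using le[of v] nonneg \<open>l \<ge> 0\<close> by (intro mult_right_mono power_increasing) auto
  finally have "hard_core E l A / (1 + l) ^ d \<le> hard_core E l ?B"
    using \<open>l \<ge> 0\<close> by (simp add: field_simps)
  then have "l * (hard_core E l A / (1 + l) ^ d) \<le> l * hard_core E l ?B"
    using \<open>l \<ge> 0\<close> by (rule mult_left_mono)
  then have "(1 + l / (1 + l) ^ d) * hard_core E l A \<le> hard_core E l (insert v A)"
    using hard_core_insert[of A v E l] insert assms by (simp add: algebra_simps)
  moreover have "(1 + l / (1 + l) ^ d) * (1 + l / (1 + l) ^ d) ^ card A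
      \<le> (1 + l / (1 + l) ^ d) * hard_core E l A"
    using insert.IH le \<open>l \<ge> 0\<close> by (intro mult_left_mono) auto
  ultimately show ?case using insert by simp
qed simp

section \<open>Counting independent sets by their defects\<close>

text \<open>A defect set \<open>T\<close> blocks at most \<open>k * card T\<close> vertices of
  \<open>I\<close>, and the rest of \<open>I\<close> can be chosen freely. Each defect thus costs at
  most a factor \<open>2 ^ k\<close>, which is the fugacity \<open>(1/2) ^ k\<close>.\<close>

lemma card_independent_subsets_ge:
  fixes E :: "'a \<Rightarrow> 'a \<Rightarrow> bool"
  assumes "finite I" "finite D" "I \<inter> D = {}" "symp E"
    and indep: "\<And>u v. u \<in> I \<Longrightarrow> v \<in> I \<Longrightarrow> \<not> E u v"
    and deg: "\<And>v. v \<in> D \<Longrightarrow> card {u \<in> I. E u v} \<le> k"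
  shows "2 ^ card I * hard_core E ((1/2) ^ k) D \<le> card (independent_subsets E (I \<union> D))"
proof -
  define N where "N T = (\<Union>v\<in>T. {u \<in> I. E u v})" for T
  let ?S = "SIGMA T:independent_subsets E D. Pow (I - N T)"
  have fin: "finite (independent_subsets E D)"
    using assms by (intro finite_independent_subsets)
  have T: "T \<subseteq> D" "finite T" if "T \<in> independent_subsets E D" for T
    using that finite_subset[of T D] \<open>finite D\<close> by (auto simp: independent_subsets_def)
  have inj: "inj_on (\<lambda>(T, J). T \<union> J) ?S"
  proof (rule inj_onI, clarify)
    fix T J T' J'
    assume h: "T \<in> independent_subsets E D" "T' \<in> independent_subsets E D"
      "J \<subseteq> I - N T" "J' \<subseteq> I - N T'" "T \<union> J = T' \<union> J'"
    \<comment> \<open>Since \<open>I\<close> and \<open>D\<close> are disjoint, a union determines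
      both of its pieces.\<close>
    have "T = (T \<union> J) \<inter> D" "T' = (T' \<union> J') \<inter> D" "J = (T \<union> J) \<inter> I" "J' = (T' \<union> J') \<inter> I"
      using h T \<open>I \<inter> D = {}\<close> by blast+
    then show "T = T' \<and> J = J'" using h(5) by metis
  qed
  have sub: "(\<lambda>(T, J). T \<union> J) ` ?S \<subseteq> independent_subsets E (I \<union> D)"
  proof clarify
    fix T J assume h: "T \<in> independent_subsets E D" "J \<subseteq> I - N T"
    have cross: "\<not> E u v" "\<not> E v u" if "u \<in> J" "v \<in> T" for u v
    proof -
      show "\<not> E u v" using that h unfolding N_def by blast
      then show "\<not> E v u" using sympD[OF \<open>symp E\<close>] by blast
    qed
    have "T \<subseteq> D" "J \<subseteq> I" "\<And>u v. u \<in> T \<Longrightarrow> v \<in> T \<Longrightarrow> \<not> E u v"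
      using h by (auto simp: independent_subsets_def)
    then show "T \<union> J \<in> independent_subsets E (I \<union> D)"
      using indep cross unfolding independent_subsets_def by blast
  qed
  have "((1/2) ^ k) ^ j = 1 / (2::real) ^ (j * k)" for j
    by (metis power_mult power_one_over mult.commute)
  then have "2 ^ card I * hard_core E ((1/2) ^ k) D
      = (\<Sum>T\<in>independent_subsets E D. 2 ^ card I / 2 ^ (card T * k))"
    by (simp add: hard_core_def sum_distrib_left)
  also have "\<dots> \<le> (\<Sum>T\<in>independent_subsets E D. real (card (Pow (I - N T))))"
  proof (rule sum_mono)
    fix T assume h: "T \<in> independent_subsets E D"
    have "card (N T) \<le> (\<Sum>v\<in>T. card {u \<in> I. E u v})"
      unfolding N_def using T[OF h] by (intro card_UN_le)
    also have "\<dots> \<le> card T * k"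
      using sum_bounded_above[of T "\<lambda>v. card {u \<in> I. E u v}" k] deg T[OF h] by auto
    finally have "card (N T) \<le> card T * k" .
    moreover have "card (I - N T) = card I - card (N T)" "finite (N T)"
      using \<open>finite I\<close> finite_subset[of "N T" I] by (auto simp: N_def intro!: card_Diff_subset)
    \<comment> \<open>The additive form avoids truncated subtraction, as \<open>card T * k\<close>
      may exceed \<open>card I\<close>.\<close>
    ultimately have "card I \<le> card (I - N T) + card T * k" by simp
    then have "(2::real) ^ card I \<le> 2 ^ (card (I - N T) + card T * k)"
      by (intro power_increasing) auto
    then show "2 ^ card I / 2 ^ (card T * k) \<le> real (card (Pow (I - N T)))"
      using \<open>finite I\<close> by (simp add: card_Pow power_add field_simps)
  qed
  also have "\<dots> = real (card ?S)"
    using fin \<open>finite I\<close> by (simp add: card_SigmaI)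
  also have "\<dots> = real (card ((\<lambda>(T, J). T \<union> J) ` ?S))"
    by (simp add: card_image[OF inj])
  also have "\<dots> \<le> card (independent_subsets E (I \<union> D))"
    using sub assms by (intro of_nat_mono card_mono finite_independent_subsets) auto
  finally show ?thesis .
qed

section \<open>Levels of the torus\<close>

abbreviation torus_verts :: "nat \<Rightarrow> nat \<Rightarrow> (nat \<Rightarrow> nat) set" where
  "torus_verts m n \<equiv> {..<n} \<rightarrow>\<^sub>E {..<m}"

text \<open>Adjacent vertices have levels that differ by one modulo \<open>m\<close>, so this is a
  homomorphism from the torus to the cycle of length \<open>m\<close>.\<close>

definition level :: "nat \<Rightarrow> nat \<Rightarrow> (nat \<Rightarrow> nat) \<Rightarrow> nat" where
  "level m n x = (\<Sum>i<n. x i) mod m"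

text \<open>A step down is the shift by \<open>m - 1\<close>, which keeps all arithmetic in the
  natural numbers.\<close>

definition shift :: "nat \<Rightarrow> (nat \<Rightarrow> nat) \<Rightarrow> nat \<Rightarrow> nat \<Rightarrow> nat \<Rightarrow> nat" where
  "shift m x a j = x(j := (x j + a) mod m)"

definition torus_adj :: "nat \<Rightarrow> nat \<Rightarrow> (nat \<Rightarrow> nat) \<Rightarrow> (nat \<Rightarrow> nat) \<Rightarrow> bool" where
  "torus_adj m n u v \<longleftrightarrow> u \<rightarrow>\<^bsub>discrete_torus m n\<^esub> v"

lemma independent_sets_discrete_torus:
  "independent_sets (discrete_torus m n) = independent_subsets (torus_adj m n) (torus_verts m n)"
  by (simp add: independent_sets_def independent_subsets_def torus_adj_def discrete_torus_def Let_def)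

lemma symp_torus_adj:
  assumes "m \<ge> 2"
  shows "symp (torus_adj m n)"
proof -
  interpret pair_graph "discrete_torus m n"
    using assms by (rule pair_graph_discrete_torus)
  show ?thesis
    using graph_symmetric by (auto simp: torus_adj_def symp_def)
qed

lemma irreflp_torus_adj:
  assumes "m \<ge> 2"
  shows "irreflp (torus_adj m n)"
proof -
  interpret pair_graph "discrete_torus m n"
    using assms by (rule pair_graph_discrete_torus)
  show ?thesis
    using adj_not_same by (auto simp: torus_adj_def irreflp_def)
qed

text \<open>Extensionality makes \<open>u\<close> and \<open>v\<close> agree outside the index range
  too, so \<open>u\<close> is \<open>v\<close> with one coordinate updated. Neighbours are thereby
  listed by a direction and a coordinate, which serves both the degree bounds and the level
  computations.\<close>

lemma torus_adj_shift:
  assumes "torus_adj m n u v" and "m > 0"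
  obtains j where "j < n" "u = shift m v 1 j \<or> u = shift m v (m - 1) j"
proof -
  from assms(1) obtain j where V: "u \<in> torus_verts m n" "v \<in> torus_verts m n" and "j < n"
    and adj: "[int (u j) = int (v j) + 1] (mod int m) \<or> [int (u j) = int (v j) - 1] (mod int m)"
    and eq: "\<And>i. i < n \<Longrightarrow> i \<noteq> j \<Longrightarrow> u i = v i"
    by (auto simp: torus_adj_def discrete_torus_def Let_def arcs_ends_def arc_to_ends_def)
  have u: "u = v(j := u j)"
  proof
    fix i show "u i = (v(j := u j)) i"
    proof (cases "i < n")
      case True
      then show ?thesis using eq[of i] by (cases "i = j") auto
    next
      case False
      then have "u i = undefined" "v i = undefined"
        using PiE_arb[OF V(1)] PiE_arb[OF V(2)] by auto
      then show ?thesis using False \<open>j < n\<close> by auto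
    qed
  qed
  have "u j < m" using V \<open>j < n\<close> by auto
  have "u j = (v j + 1) mod m \<or> u j = (v j + (m - 1)) mod m"
    using adj
  proof
    assume "[int (u j) = int (v j) + 1] (mod int m)"
    then have "[int (u j) = int (v j + 1)] (mod int m)" by (simp add: add.commute)
    then show ?thesis using \<open>u j < m\<close> unfolding cong_int_iff by (simp add: cong_def)
  next
    assume "[int (u j) = int (v j) - 1] (mod int m)"
    \<comment> \<open>Adding \<open>m\<close> turns the right-hand side into the image of a natural
      number.\<close>
    then have "[int (u j) = int (v j) - 1 + int m] (mod int m)" by (simp add: cong_def)
    also have "int (v j) - 1 + int m = int (v j + (m - 1))" using \<open>m > 0\<close> by auto
    finally show ?thesis using \<open>u j < m\<close> unfolding cong_int_iff by (simp add: cong_def)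
  qed
  then show thesis using u \<open>j < n\<close> that unfolding shift_def by metis
qed

lemma level_shift:
  assumes "j < n"
  shows "level m n (shift m v a j) = (level m n v + a) mod m"
proof -
  have "(\<Sum>i<n. shift m v a j i) = (v j + a) mod m + (\<Sum>i\<in>{..<n} - {j}. v i)"
    using assms by (simp add: shift_def sum.remove[of "{..<n}" j])
  moreover have "(\<Sum>i<n. v i) = v j + (\<Sum>i\<in>{..<n} - {j}. v i)"
    using assms by (simp add: sum.remove[of "{..<n}" j])
  ultimately show ?thesis
    unfolding level_def by (simp add: mod_simps ac_simps)
qed

lemma card_torus_adj_le:
  assumes "m > 0" "finite A"
  shows "card {u \<in> A. torus_adj m n u v} \<le> 2 * n"
proof -
  have "{u \<in> A. torus_adj m n u v} \<subseteq> shift m v 1 ` {..<n} \<union> shift m v (m - 1) ` {..<n}"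
    using assms by (auto elim!: torus_adj_shift)
  then have "card {u \<in> A. torus_adj m n u v}
      \<le> card (shift m v 1 ` {..<n} \<union> shift m v (m - 1) ` {..<n})"
    by (intro card_mono) auto
  also have "\<dots> \<le> card (shift m v 1 ` {..<n}) + card (shift m v (m - 1) ` {..<n})"
    by (rule card_Un_le)
  also have "\<dots> \<le> n + n"
    by (intro add_mono card_image_le[THEN order_trans]) auto
  finally show ?thesis by simp
qed

text \<open>The first \<open>n\<close> coordinates are free, and the last one can be chosen to reach
  any prescribed level.\<close>

lemma card_levels_ge:
  assumes "L \<subseteq> {..<m}"
  shows "card L * m ^ n \<le> card {x \<in> torus_verts m (Suc n). level m (Suc n) x \<in> L}"
proof -
  \<comment> \<open>Modulo \<open>m\<close> the factor \<open>m - 1\<close> acts as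
    \<open>-1\<close>, so the new coordinate cancels the sum of the others and leaves level
    \<open>c\<close>.\<close>
  define f where "f = (\<lambda>(y :: nat \<Rightarrow> nat, c). y(n := (c + (m - 1) * (\<Sum>i<n. y i)) mod m))"
  have level_f: "level m (Suc n) (f (y, c)) = c" if "c < m" for y c
  proof -
    have "(\<Sum>i<Suc n. f (y, c) i) = (\<Sum>i<n. y i) + (c + (m - 1) * (\<Sum>i<n. y i)) mod m"
      by (simp add: f_def)
    then have "level m (Suc n) (f (y, c)) = ((\<Sum>i<n. y i) + (c + (m - 1) * (\<Sum>i<n. y i))) mod m"
      by (simp add: level_def mod_simps)
    also have "(\<Sum>i<n. y i) + (c + (m - 1) * (\<Sum>i<n. y i)) = c + m * (\<Sum>i<n. y i)"
      using that by (cases m) auto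
    finally show ?thesis using that by simp
  qed
  have inj: "inj_on f (torus_verts m n \<times> L)"
  proof (rule inj_onI, clarify)
    fix y c y' c'
    assume h: "y \<in> torus_verts m n" "y' \<in> torus_verts m n" "c \<in> L" "c' \<in> L"
      and eq: "f (y, c) = f (y', c')"
    have "c < m" "c' < m" using h assms by auto
    then have "c = c'" using eq level_f by metis
    moreover have "y = y'"
    proof
      fix i show "y i = y' i"
      proof (cases "i < n")
        case True
        then show ?thesis using fun_cong[OF eq, of i] by (simp add: f_def)
      next
        case False
        then show ?thesis using PiE_arb[OF h(1)] PiE_arb[OF h(2)] by simp
      qed
    qed
    ultimately show "y = y' \<and> c = c'" by blast
  qed
  have "f ` (torus_verts m n \<times> L) \<subseteq> {x \<in> torus_verts m (Suc n). level m (Suc n) x \<in> L}"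
  proof clarify
    fix y c assume h: "y \<in> torus_verts m n" "c \<in> L"
    then have "c < m" using assms by auto
    then have "f (y, c) \<in> torus_verts m (Suc n)"
      unfolding f_def lessThan_Suc prod.case using h(1) by (intro PiE_fun_upd) auto
    then show "f (y, c) \<in> torus_verts m (Suc n) \<and> level m (Suc n) (f (y, c)) \<in> L"
      using level_f \<open>c < m\<close> h by simp
  qed
  then have "card (f ` (torus_verts m n \<times> L))
      \<le> card {x \<in> torus_verts m (Suc n). level m (Suc n) x \<in> L}"
    by (intro card_mono) (auto intro!: finite_PiE)
  then show ?thesis
    using card_image[OF inj] by (simp add: card_cartesian_product card_PiE mult.commute)
qed

section \<open>The explicit bound for the torus\<close>

lemma card_independent_sets_ge:
  assumes "m \<ge> 3" "odd m" "n \<ge> 1"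
  defines "l \<equiv> (1/2) ^ n"
  shows "2 ^ (m div 2 * m ^ (n - 1)) * (1 + l / (1 + l) ^ (2 * n)) ^ (2 * m ^ (n - 1))
    \<le> real (card (independent_sets (discrete_torus m n)))"
proof -
  let ?E = "torus_adj m n"
  \<comment> \<open>The cutoff stops at level \<open>m - 3\<close>; the gap of two levels before the
    cycle closes up at \<open>0\<close> is filled by \<open>D\<close>.\<close>
  define I where "I = {x \<in> torus_verts m n. level m n x \<in> {c. even c \<and> c + 2 < m}}"
  define D where "D = {x \<in> torus_verts m n. level m n x \<in> {m - 2, m - 1}}"
  have fin: "finite (torus_verts m n)" by (intro finite_PiE) auto
  have finI: "finite I" and finD: "finite D"
    using fin by (simp_all add: I_def D_def)
  have disj: "I \<inter> D = {}"
  proof -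
    have "{c. even c \<and> c + 2 < m} \<inter> {m - 2, m - 1} = {}" by auto
    then show ?thesis unfolding I_def D_def by blast
  qed
  have sym: "symp ?E" and irrefl: "irreflp ?E"
    using \<open>m \<ge> 3\<close> by (auto intro: symp_torus_adj irreflp_torus_adj)
  have n: "Suc (n - 1) = n" using \<open>n \<ge> 1\<close> by simp
  have pred: "(c + (m - 1)) mod m = (if c = 0 then m - 1 else c - 1)" if "c < m" for c
  proof (cases "c = 0")
    case False
    then have "c + (m - 1) = (c - 1) + m" using that by simp
    then have "(c + (m - 1)) mod m = (c - 1) mod m" by (simp only: mod_add_self2)
    then show ?thesis using that False by simp
  qed (use \<open>m \<ge> 3\<close> in simp)
  have succ: "(c + 1) mod m = (if c = m - 1 then 0 else c + 1)" if "c < m" for c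
    using that by auto

  \<comment> \<open>Oddness enters here: for \<open>m = 2 * q + 1\<close> the condition on
    \<open>c = 2 * k\<close> reads \<open>k < q\<close>.\<close>
  have "{c. even c \<and> c + 2 < m} = (\<lambda>k. 2 * k) ` {..<m div 2}"
    using \<open>odd m\<close> by (auto elim!: evenE oddE)
  then have "card {c. even c \<and> c + 2 < m} = m div 2"
    by (simp add: card_image inj_on_def)
  moreover have "{c. even c \<and> c + 2 < m} \<subseteq> {..<m}" by auto
  ultimately have cardI: "m div 2 * m ^ (n - 1) \<le> card I"
    using card_levels_ge[of "{c. even c \<and> c + 2 < m}" m "n - 1"] unfolding I_def n by metis
  have "card {m - 2, m - 1} = 2" "{m - 2, m - 1} \<subseteq> {..<m}" using \<open>m \<ge> 3\<close> by auto
  then have cardD: "2 * m ^ (n - 1) \<le> card D"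
    using card_levels_ge[of "{m - 2, m - 1}" m "n - 1"] unfolding D_def n by metis

  \<comment> \<open>A step that does not wrap around changes the parity of the level, and a step
    that wraps around has an end at level \<open>m - 1\<close>, which \<open>I\<close>
    avoids.\<close>
  have indep: "\<not> ?E u v" if "u \<in> I" "v \<in> I" for u v
  proof
    assume "?E u v"
    then obtain j where "j < n" "u = shift m v 1 j \<or> u = shift m v (m - 1) j"
      using \<open>m \<ge> 3\<close> by (auto elim!: torus_adj_shift)
    then have "level m n u = (level m n v + 1) mod m \<or> level m n u = (level m n v + (m - 1)) mod m"
      using level_shift by blast
    moreover have "even (level m n v)" "level m n v + 2 < m" "even (level m n u)" "level m n u + 2 < m"
      using that by (auto simp: I_def)
    ultimately show False
      using pred[of "level m n v"] succ[of "level m n v"] by (auto split: if_splits)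
  qed
  \<comment> \<open>From each defect level one of the two directions leads to the other defect
    level. Only \<open>n\<close> of the \<open>2 * n\<close> shifts can therefore land in
    \<open>I\<close>.\<close>
  have top: "(m - 2 + 1) mod m = m - 1" "(m - 1 + (m - 1)) mod m = m - 2"
  proof -
    have "m - 2 + 1 = m - 1" "m - 2 < m" "m - 1 - 1 = m - 2" using \<open>m \<ge> 3\<close> by auto
    then show "(m - 2 + 1) mod m = m - 1" "(m - 1 + (m - 1)) mod m = m - 2"
      using pred[of "m - 1"] \<open>m \<ge> 3\<close> by auto
  qed
  have degI: "card {u \<in> I. ?E u v} \<le> n" if "v \<in> D" for v
  proof -
    \<comment> \<open>The direction away from the other defect level: down from
      \<open>m - 2\<close>, and up from \<open>m - 1\<close>, where it wraps around to
      \<open>0\<close>.\<close>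
    define a where "a = (if level m n v = m - 2 then m - 1 else 1)"
    have "{u \<in> I. ?E u v} \<subseteq> shift m v a ` {..<n}"
    proof clarify
      fix u assume "u \<in> I" "?E u v"
      then obtain j where j: "j < n" "u = shift m v 1 j \<or> u = shift m v (m - 1) j"
        using \<open>m \<ge> 3\<close> by (auto elim!: torus_adj_shift)
      have "level m n (shift m v 1 j) = m - 1" if "level m n v = m - 2"
        unfolding level_shift[OF j(1)] that using top(1) .
      moreover have "level m n (shift m v (m - 1) j) = m - 2" if "level m n v = m - 1"
        unfolding level_shift[OF j(1)] that using top(2) .
      moreover have "level m n u + 2 < m" using \<open>u \<in> I\<close> by (auto simp: I_def)
      moreover have "level m n v = m - 2 \<or> level m n v = m - 1" using \<open>v \<in> D\<close> by (auto simp: D_def)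
      ultimately have "u = shift m v a j" using j(2) by (auto simp: a_def)
      then show "u \<in> shift m v a ` {..<n}" using j(1) by blast
    qed
    then have "card {u \<in> I. ?E u v} \<le> card (shift m v a ` {..<n})" by (intro card_mono) auto
    also have "\<dots> \<le> n" by (rule card_image_le[THEN order_trans]) auto
    finally show ?thesis .
  qed

  have l: "l \<ge> 0" by (simp add: l_def)
  have "2 ^ (m div 2 * m ^ (n - 1)) * (1 + l / (1 + l) ^ (2 * n)) ^ (2 * m ^ (n - 1))
      \<le> 2 ^ card I * (1 + l / (1 + l) ^ (2 * n)) ^ card D"
    using cardI cardD l by (intro mult_mono power_increasing) auto
  \<comment> \<open>Inside \<open>D\<close> both directions may occur, so the degree bound used is
    \<open>2 * n\<close>.\<close>
  also have "\<dots> \<le> 2 ^ card I * hard_core ?E l D"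
    using hard_core_ge[OF finD sym irrefl l] card_torus_adj_le[OF _ finD] \<open>m \<ge> 3\<close>
    by (intro mult_left_mono) auto
  also have "\<dots> \<le> card (independent_subsets ?E (I \<union> D))"
    unfolding l_def using finI finD disj sym indep degI by (rule card_independent_subsets_ge)
  also have "\<dots> \<le> card (independent_subsets ?E (torus_verts m n))"
    using fin by (intro of_nat_mono card_mono finite_independent_subsets)
      (auto simp: independent_subsets_def I_def D_def)
  finally show ?thesis by (simp add: independent_sets_discrete_torus)
qed

section \<open>Passing to the exponential form\<close>

theorem theorem1p2:
  fixes m :: nat
  assumes "m \<ge> 3" and "odd m"
  shows "\<exists>\<epsilon> :: nat \<Rightarrow> real. \<epsilon> \<longlonglongrightarrow> 0 \<and>
    (\<forall>n\<ge>1. real (card (independent_sets (discrete_torus m n)))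
       \<ge> 2 ^ (m div 2 * m ^ (n - 1)) * exp ((1 - \<epsilon> n) * (real m / 2) ^ (n - 1)))"
proof -
  define l :: "nat \<Rightarrow> real" where "l n = (1/2) ^ n" for n
  \<comment> \<open>The relative gain per defect vertex in
    \<open>card_independent_sets_ge\<close>.\<close>
  define \<mu> where "\<mu> n = l n / (1 + l n) ^ (2 * n)" for n
  \<comment> \<open>Chosen so that \<open>(1 - \<epsilon> n) * l n\<close> equals
    \<open>\<mu> n - (\<mu> n)\<^sup>2\<close>, the lower bound for \<open>ln (1 + \<mu> n)\<close>
    used below. It tends to \<open>0\<close> because \<open>n * l n\<close> does, so that
    \<open>(1 + l n) ^ (2 * n)\<close> tends to \<open>1\<close>.\<close>
  define \<epsilon> where "\<epsilon> n = 1 - (1 - \<mu> n) / (1 + l n) ^ (2 * n)" for n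
  have lim: "\<epsilon> \<longlonglongrightarrow> 0"
    unfolding \<epsilon>_def \<mu>_def l_def by real_asymp
  have bound: "2 ^ (m div 2 * m ^ (n - 1)) * exp ((1 - \<epsilon> n) * (real m / 2) ^ (n - 1))
      \<le> real (card (independent_sets (discrete_torus m n)))" if "n \<ge> 1" for n
  proof -
    have l: "0 \<le> l n" "l n \<le> 1" by (auto simp: l_def power_le_one)
    \<comment> \<open>This gives \<open>\<mu> n \<le> 1\<close>, which the logarithm bound
      requires.\<close>
    have "l n \<le> (1 + l n) ^ (2 * n)"
      using l by (intro order_trans[OF l(2) one_le_power]) simp
    then have "0 \<le> \<mu> n" "\<mu> n \<le> 1"
      using l by (simp_all add: \<mu>_def pos_divide_le_eq)
    then have "\<mu> n - (\<mu> n)\<^sup>2 \<le> ln (1 + \<mu> n)"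
      by (rule ln_one_plus_pos_lower_bound)
    then have "exp (\<mu> n - (\<mu> n)\<^sup>2) \<le> 1 + \<mu> n"
      using \<open>0 \<le> \<mu> n\<close> by (metis add_pos_nonneg exp_le_cancel_iff exp_ln zero_less_one)
    then have "exp (\<mu> n - (\<mu> n)\<^sup>2) ^ (2 * m ^ (n - 1)) \<le> (1 + \<mu> n) ^ (2 * m ^ (n - 1))"
      by (intro power_mono) auto
    \<comment> \<open>The factor 2 from the two defect levels turns \<open>l n\<close> into
      \<open>(1/2) ^ (n - 1)\<close>, matching the exponent of \<open>m\<close>.\<close>
    moreover have "(1 - \<epsilon> n) * (real m / 2) ^ (n - 1) = real (2 * m ^ (n - 1)) * (\<mu> n - (\<mu> n)\<^sup>2)"
    proof -
      obtain k where "n = Suc k" using \<open>n \<ge> 1\<close> by (cases n) auto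
      moreover have "\<mu> n - (\<mu> n)\<^sup>2 = (1 - \<epsilon> n) * l n"
        by (simp add: \<epsilon>_def \<mu>_def power2_eq_square left_diff_distrib diff_divide_distrib)
      ultimately show ?thesis
        by (simp add: l_def power_divide)
    qed
    ultimately have "exp ((1 - \<epsilon> n) * (real m / 2) ^ (n - 1)) \<le> (1 + \<mu> n) ^ (2 * m ^ (n - 1))"
      by (metis exp_of_nat_mult)
    then have "2 ^ (m div 2 * m ^ (n - 1)) * exp ((1 - \<epsilon> n) * (real m / 2) ^ (n - 1))
        \<le> 2 ^ (m div 2 * m ^ (n - 1)) * (1 + \<mu> n) ^ (2 * m ^ (n - 1))"
      by (intro mult_left_mono) auto
    also have "\<dots> \<le> real (card (independent_sets (discrete_torus m n)))"
      using card_independent_sets_ge[OF assms that] by (simp add: \<mu>_def l_def)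
    finally show ?thesis .
  qed
  show ?thesis using lim bound by blast
qed

end
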